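(* (Computation Formula) Let $(f,U,y)$ be an admissible triple in $\mathbb{R}^k$. Assume that, at any $x\in f^{-1}(y)\cap U$, $f$ is Fréchet differentiable with nonsingular derivative. Then $f^{-1}(y)\cap U$ is finite and $$\deg(f,U,y)=\sum_{x\in f^{-1}(y)\cap U}\mathrm{i}(f,x).$$
   Context: Here $k$ is a positive integer, all maps are assumed continuous, and $\overline U$, $\partial U$ denote the closure and boundary of $U$ in $\mathbb{R}^k$. A map between metric spaces is proper if preimages of compact sets are compact. Triples: $(f,U,y)$ consists of an open set $U\subseteq\mathbb{R}^k$, an $\mathbb{R}^k$-valued map $f$ defined (at least) on $\overline U$, and $y\in\mathbb{R}^k$. It is admissible if $f$ is proper on $\overline U$ (i.e. $f|_{\overline U}$ is proper) and $f(x)\neq y$ for all $x\in\partial U$. Index: if $f$ is Fréchet differentiable at $x$ with invertible derivative, $\mathrm{i}(f,x):=\mathrm{sign}(\det f'(x))$. Homotopies: $(H,U,\alpha)$, where $U\subseteq\mathbb{R}^k$ is open, $H$ is an $\mathbb{R}^k$-valued map defined (at least) on $\overline U\times[0,1]$ and $\alpha:[0,1]\to\mathbb{R}^k$ is a path, is an admissible homotopy if $H$ is proper on $\overline U\times[0,1]$ and $H(x,\lambda)\neq\alpha(\lambda)$ for all $(x,\lambda)\in\partial U\times[0,1]$. Degree (axiomatic point of view): $\deg$ is a map assigning to every admissible triple $(f,U,y)$ in $\mathbb{R}^k$ an integer $\deg(f,U,y)$ and satisfying: (Normalization) $\deg(I,\mathbb{R}^k,0)=1$, with $I$ the identity on $\mathbb{R}^k$;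 (Additivity) if $(f,U,y)$ is admissible and $U_1,U_2$ are disjoint open subsets of $U$ with $f^{-1}(y)\cap U\subseteq U_1\cup U_2$, then $\deg(f,U,y)=\deg(f,U_1,y)+\deg(f,U_2,y)$; (Homotopy Invariance) if $(H,U,\alpha)$ is an admissible homotopy, then $\deg(H(\cdot,0),U,\alpha(0))=\deg(H(\cdot,1),U,\alpha(1))$. *)

theory Defs
  imports "HOL-Analysis.Analysis"
begin

text \<open>
  A map that is defined at least on a set \<open>S\<close> is represented by a total function whose
  values outside \<open>S\<close> are irrelevant: continuity and properness are only ever required on \<open>S\<close>.
\<close>

definition proper_on :: "'a::metric_space set \<Rightarrow> ('a \<Rightarrow> 'b::metric_space) \<Rightarrow> bool" where
  "proper_on S f \<longleftrightarrow> continuous_on S f \<and> (\<forall>K. compact K \<longrightarrow> compact (f -` K \<inter> S))"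

definition admissible ::
    "(real^'n \<Rightarrow> real^'n) \<Rightarrow> (real^'n) set \<Rightarrow> real^'n \<Rightarrow> bool" where
  "admissible f U y \<longleftrightarrow>
     open U \<and> proper_on (closure U) f \<and> (\<forall>x\<in>frontier U. f x \<noteq> y)"

definition admissible_homotopy ::
    "((real^'n) \<times> real \<Rightarrow> real^'n) \<Rightarrow> (real^'n) set \<Rightarrow> (real \<Rightarrow> real^'n) \<Rightarrow> bool" where
  "admissible_homotopy H U \<alpha> \<longleftrightarrow>
     open U \<and> path \<alpha> \<and> proper_on (closure U \<times> {0..1}) H \<and>
     (\<forall>x\<in>frontier U. \<forall>t\<in>{0..1}. H (x, t) \<noteq> \<alpha> t)"

text \<open>
  The Brouwer degree from the axiomatic point of view. The values of \<open>deg\<close> on triples that are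
  not admissible are unconstrained. In the additivity and homotopy clauses the triples
  on the right-hand sides are automatically admissible.
\<close>

definition brouwer_degree ::
    "((real^'n \<Rightarrow> real^'n) \<Rightarrow> (real^'n) set \<Rightarrow> real^'n \<Rightarrow> int) \<Rightarrow> bool" where
  "brouwer_degree deg \<longleftrightarrow>
     deg (\<lambda>x. x) UNIV 0 = 1 \<and>
     (\<forall>f U y U1 U2.
        admissible f U y \<and> open U1 \<and> open U2 \<and> U1 \<subseteq> U \<and> U2 \<subseteq> U \<and> U1 \<inter> U2 = {} \<and>
        f -` {y} \<inter> U \<subseteq> U1 \<union> U2 \<longrightarrow>
        deg f U y = deg f U1 y + deg f U2 y) \<and>
     (\<forall>H U \<alpha>.
        admissible_homotopy H U \<alpha> \<longrightarrow>
        deg (\<lambda>x. H (x, 0)) U (\<alpha> 0) = deg (\<lambda>x. H (x, 1)) U (\<alpha> 1))"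

text \<open>
  The index is the sign of the Jacobian determinant, as an integer. It is meaningful only where
  \<open>f\<close> is differentiable with invertible derivative.
\<close>

definition point_index :: "(real^'n \<Rightarrow> real^'n) \<Rightarrow> real^'n \<Rightarrow> int" where
  "point_index f x =
     (let d = det (jacobian f (at x)) in if d > 0 then 1 else if d < 0 then - 1 else 0)"

end

theory Submission imports Defs begin

text \<open>
  Additivity and homotopy invariance localise the degree at the zeros of \<open>f - y\<close>, where the map
  is homotopic to its affine approximation; so everything reduces to the degree of an invertible
  matrix on the whole space. Right multiplication by a shear or by a positive diagonal matrix
  does not change that degree, since it can be joined to the identity through invertible matrices.
  Right multiplication by a reflection negates it, by splitting a folded map without zeros into
  its two affine pieces. These matrices generate the general linear group, and the determinant
  has the same behaviour up to sign.
\<close>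

section \<open>Proper maps and admissible triples\<close>

lemma proper_on_subset:
  assumes "proper_on S f" "closed T" "T \<subseteq> S"
  shows "proper_on T f"
  unfolding proper_on_def
proof (intro conjI allI impI)
  show "continuous_on T f"
    using assms continuous_on_subset unfolding proper_on_def by blast
  fix K :: "'b set" assume "compact K"
  then have "compact (f -` K \<inter> S)"
    using assms unfolding proper_on_def by blast
  then have "compact (T \<inter> (f -` K \<inter> S))"
    using closed_Int_compact assms(2) by blast
  moreover have "T \<inter> (f -` K \<inter> S) = f -` K \<inter> T"
    using assms(3) by auto
  ultimately show "compact (f -` K \<inter> T)" by simp
qed

lemma proper_on_compact:
  assumes "compact S" "continuous_on S f"
  shows "proper_on S f"
  unfolding proper_on_def
proof (intro conjI allI impI)
  fix K :: "'b set" assume "compact K"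
  then have "closed (f -` K \<inter> S)"
    using assms by (intro closed_vimage_Int compact_imp_closed)
  then have "compact (S \<inter> (f -` K \<inter> S))"
    using assms(1) compact_Int_closed by blast
  then show "compact (f -` K \<inter> S)" by (simp add: Int_absorb1)
qed (use assms in auto)

text \<open>The lower bound makes preimages of bounded sets bounded and continuity makes preimages
  of compact sets closed, so Heine-Borel applies. The constant \<open>C\<close> leaves room for
  translations.\<close>

lemma proper_on_growth:
  fixes f :: "'a::{heine_borel,real_normed_vector} \<Rightarrow> 'b::real_normed_vector"
  assumes "continuous_on S f" "closed S" "c > 0"
    and growth: "\<And>x. x \<in> S \<Longrightarrow> c * norm x \<le> norm (f x) + C"
  shows "proper_on S f"
  unfolding proper_on_def
proof (intro conjI allI impI)
  fix K :: "'b set" assume K: "compact K"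
  then obtain B where B: "\<And>z. z \<in> K \<Longrightarrow> norm z \<le> B"
    using compact_imp_bounded bounded_iff by metis
  have "norm x \<le> (B + C) / c" if "x \<in> f -` K \<inter> S" for x
    using growth[of x] B[of "f x"] that \<open>c > 0\<close> by (auto simp: field_simps)
  then have "bounded (f -` K \<inter> S)"
    by (auto simp: bounded_iff)
  moreover have "closed (f -` K \<inter> S)"
    using assms K compact_imp_closed by (intro closed_vimage_Int) auto
  ultimately show "compact (f -` K \<inter> S)"
    by (simp add: compact_eq_bounded_closed)
qed (use assms in auto)

lemma proper_on_cong:
  assumes "proper_on S f" "\<And>x. x \<in> S \<Longrightarrow> f x = g x"
  shows "proper_on S g"
proof -
  have "f -` K \<inter> S = g -` K \<inter> S" for K
    using assms(2) by auto
  then show ?thesis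
    using assms continuous_on_cong[of S S f g] unfolding proper_on_def by auto
qed

lemma admissible_mono:
  assumes "admissible f U y" "open V" "V \<subseteq> U" "\<And>x. x \<in> frontier V \<Longrightarrow> f x \<noteq> y"
  shows "admissible f V y"
  using assms proper_on_subset[of "closure U" f "closure V"] closure_mono
  unfolding admissible_def by blast

text \<open>No zero lies on the frontier. The right-hand side is a set to which properness applies,
  which later gives compactness of the zero set.\<close>

lemma admissible_zeros:
  assumes "admissible f U y"
  shows "f -` {y} \<inter> U = f -` {y} \<inter> closure U"
  using assms closure_subset[of U]
  unfolding admissible_def frontier_def by (auto simp: interior_open)

section \<open>Invertible matrices and affine maps\<close>

lemma matrix_bounded_below:
  fixes A :: "real^'n^'n"
  assumes "det A \<noteq> 0"
  obtains c where "c > 0" "\<And>x. c * norm x \<le> norm (A *v x)"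
proof -
  have "inj ((*v) A)"
    using assms by (simp add: inj_matrix_vector_mult invertible_det_nz)
  then show ?thesis
    using linear_inj_bounded_below_pos[of "(*v) A"] that by auto
qed

lemma det_nonzero_cancel:
  fixes A :: "real^'n^'n"
  assumes "det A \<noteq> 0"
  shows "A *v x = A *v y \<longleftrightarrow> x = y"
  using inj_matrix_vector_mult[of A] assms by (auto simp: invertible_det_nz inj_eq)

lemma affine_growth:
  fixes A :: "real^'n^'n"
  assumes "det A \<noteq> 0"
  obtains c where "c > 0" "\<And>x. c * norm x \<le> norm (A *v x + w) + norm w"
proof -
  obtain c where "c > 0" "\<And>x. c * norm x \<le> norm (A *v x)"
    using matrix_bounded_below assms by blast
  moreover have "norm (A *v x) \<le> norm (A *v x + w) + norm w" for x
    using norm_triangle_ineq4[of "A *v x + w" w] by simp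
  ultimately show ?thesis
    using that order_trans by blast
qed

lemma admissible_affine:
  fixes A :: "real^'n^'n"
  assumes "det A \<noteq> 0"
  shows "admissible (\<lambda>x. A *v x + w) UNIV y"
proof -
  obtain c where "c > 0" "\<And>x. c * norm x \<le> norm (A *v x + w) + norm w"
    using affine_growth assms by blast
  then have "proper_on UNIV (\<lambda>x. A *v x + w)"
    by (intro proper_on_growth[where c=c and C="norm w"]) (auto intro!: continuous_intros)
  then show ?thesis
    by (simp add: admissible_def)
qed

context
  fixes deg :: "(real^'n \<Rightarrow> real^'n) \<Rightarrow> (real^'n) set \<Rightarrow> real^'n \<Rightarrow> int"
  assumes deg: "brouwer_degree deg"
begin

section \<open>First consequences of the degree axioms\<close>

lemma deg_additive:
  assumes "admissible f U y" "open U1" "open U2" "U1 \<subseteq> U" "U2 \<subseteq> U" "U1 \<inter> U2 = {}"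
    "f -` {y} \<inter> U \<subseteq> U1 \<union> U2"
  shows "deg f U y = deg f U1 y + deg f U2 y"
  using deg assms unfolding brouwer_degree_def by blast

lemma deg_homotopy:
  assumes "admissible_homotopy H U \<alpha>"
  shows "deg (\<lambda>x. H (x, 0)) U (\<alpha> 0) = deg (\<lambda>x. H (x, 1)) U (\<alpha> 1)"
  using deg assms unfolding brouwer_degree_def by blast

text \<open>Additivity with all three sets empty reads \<open>d = d + d\<close>.\<close>

lemma deg_empty: "deg f {} y = 0"
proof -
  have "admissible f {} y"
    by (simp add: admissible_def proper_on_def)
  from deg_additive[OF this, of "{}" "{}"] show ?thesis by simp
qed

lemma deg_excision:
  assumes "admissible f U y" "open V" "V \<subseteq> U" "f -` {y} \<inter> U \<subseteq> V"
  shows "deg f U y = deg f V y"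
  using deg_additive[OF assms(1), of V "{}"] assms by (simp add: deg_empty)

lemma deg_no_zeros:
  assumes "admissible f U y" "f -` {y} \<inter> U = {}"
  shows "deg f U y = 0"
  using deg_excision[OF assms(1), of "{}"] assms by (simp add: deg_empty)

text \<open>Since \<open>deg\<close> takes total functions, its independence of the values off
  \<open>closure U\<close> has to be derived; homotopy invariance yields it.\<close>

lemma deg_cong:
  assumes "admissible f U y" "\<And>x. x \<in> closure U \<Longrightarrow> f x = g x"
  shows "deg f U y = deg g U y"
proof -
  \<comment> \<open>The jump after time 0 is harmless: over \<open>closure U\<close> the two maps
    coincide, so there \<open>H\<close> does not depend on \<open>t\<close>.\<close>
  define H where "H = (\<lambda>(x, t::real). if t = 0 then f x else g x)"
  have fprop: "proper_on (closure U) f" and "open U" and nz: "\<And>x. x \<in> frontier U \<Longrightarrow> f x \<noteq> y"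
    using assms(1) by (auto simp: admissible_def)
  have "proper_on (closure U \<times> {0..1::real}) (\<lambda>z. f (fst z))"
    unfolding proper_on_def
  proof (intro conjI allI impI)
    show "continuous_on (closure U \<times> {0..1::real}) (\<lambda>z. f (fst z))"
      using fprop unfolding proper_on_def
      by (intro continuous_on_compose2[of "closure U" f _ fst] continuous_on_fst continuous_on_id)
        auto
    fix K :: "(real^'n) set" assume "compact K"
    then have "compact ((f -` K \<inter> closure U) \<times> {0..1::real})"
      using fprop unfolding proper_on_def by (intro compact_Times) auto
    moreover have "(f -` K \<inter> closure U) \<times> {0..1::real}
        = (\<lambda>z. f (fst z)) -` K \<inter> closure U \<times> {0..1}"
      by auto
    ultimately show "compact ((\<lambda>z. f (fst z)) -` K \<inter> closure U \<times> {0..1::real})" by simp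
  qed
  then have "proper_on (closure U \<times> {0..1::real}) H"
    by (rule proper_on_cong) (auto simp: H_def assms(2))
  moreover have "H (x, t) \<noteq> y" if "x \<in> frontier U" for x t
    using nz[OF that] assms(2)[of x] that by (auto simp: H_def frontier_def)
  ultimately have "admissible_homotopy H U (\<lambda>_. y)"
    using \<open>open U\<close> by (simp add: admissible_homotopy_def path_def)
  from deg_homotopy[OF this] show ?thesis
    by (simp add: H_def)
qed

section \<open>Homotopies on the whole space\<close>

lemma deg_homotopy_UNIV:
  fixes H :: "(real^'n) \<times> real \<Rightarrow> real^'n"
  assumes "continuous_on (UNIV \<times> {0..1}) H" "path \<alpha>" "c > 0"
    and growth: "\<And>x t. t \<in> {0..1} \<Longrightarrow> c * norm x \<le> norm (H (x, t)) + C"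
  shows "deg (\<lambda>x. H (x, 0)) UNIV (\<alpha> 0) = deg (\<lambda>x. H (x, 1)) UNIV (\<alpha> 1)"
proof -
  have "proper_on (UNIV \<times> {0..1}) H"
  proof (rule proper_on_growth[where c=c and C="C+c"])
    fix z :: "(real^'n) \<times> real" assume z: "z \<in> UNIV \<times> {0..1}"
    obtain x t where xt: "z = (x, t)" by (cases z)
    \<comment> \<open>The time coordinate adds at most 1 to the norm, which accounts for the
      constant \<open>C + c\<close>.\<close>
    have "norm z \<le> norm x + 1"
      using norm_Pair_le[of x t] z xt by auto
    then have "c * norm z \<le> c * norm x + c"
      using mult_left_mono[of "norm z" "norm x + 1" c] \<open>c > 0\<close> by (simp add: algebra_simps)
    also have "\<dots> \<le> norm (H z) + (C + c)"
      using growth[of t x] z xt by auto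
    finally show "c * norm z \<le> norm (H z) + (C + c)" .
  qed (use assms in \<open>auto intro!: closed_Times\<close>)
  then have "admissible_homotopy H UNIV \<alpha>"
    using assms by (simp add: admissible_homotopy_def)
  then show ?thesis by (rule deg_homotopy)
qed

text \<open>The translation and the target shrink to 0 together, so a moving target \<alpha> is used
  here; the growth bound of \<open>A\<close> is uniform in time.\<close>

lemma deg_affine:
  assumes "det A \<noteq> 0"
  shows "deg (\<lambda>x. A *v x + w) UNIV y = deg ((*v) A) UNIV 0"
proof -
  obtain c where c: "c > 0" "\<And>x. c * norm x \<le> norm (A *v x)"
    using matrix_bounded_below assms by blast
  define H where "H = (\<lambda>(x, t). A *v x + (1 - t) *\<^sub>R w)"
  have "deg (\<lambda>x. H (x, 0)) UNIV ((1 - 0) *\<^sub>R y) = deg (\<lambda>x. H (x, 1)) UNIV ((1 - 1) *\<^sub>R y)"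
  proof (rule deg_homotopy_UNIV[where c=c and C="norm w"])
    show "continuous_on (UNIV \<times> {0..1}) H"
      unfolding H_def case_prod_beta
      by (intro continuous_intros continuous_on_compose2[of UNIV "(*v) A"]) auto
    show "path (\<lambda>t. (1 - t) *\<^sub>R y)"
      unfolding path_def by (intro continuous_intros)
    fix x and t :: real assume t: "t \<in> {0..1}"
    have "norm (A *v x) \<le> norm (H (x, t)) + norm ((1 - t) *\<^sub>R w)"
      using norm_triangle_ineq4[of "H (x, t)" "(1 - t) *\<^sub>R w"] by (simp add: H_def)
    moreover have "norm ((1 - t) *\<^sub>R w) \<le> norm w"
      using t by (simp add: mult_left_le_one_le)
    ultimately show "c * norm x \<le> norm (H (x, t)) + norm w"
      using c(2)[of x] by linarith
  qed fact
  then show ?thesis by (simp add: H_def)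
qed

section \<open>The degree of an invertible matrix\<close>

text \<open>Injectivity along the segment becomes a uniform lower bound by compactness of the unit
  sphere times the unit interval, and this bound makes the homotopy proper.\<close>

lemma deg_segment:
  assumes "\<And>t x. \<lbrakk>t \<in> {0..1}; (1 - t) *\<^sub>R (A *v x) + t *\<^sub>R (B *v x) = 0\<rbrakk> \<Longrightarrow> x = 0"
  shows "deg ((*v) A) UNIV 0 = deg ((*v) B) UNIV 0"
proof -
  define H where "H = (\<lambda>(x, t). (1 - t) *\<^sub>R (A *v x) + t *\<^sub>R (B *v x))"
  have cont: "continuous_on S H" for S
    unfolding H_def case_prod_beta
    by (intro continuous_intros matrix_vector_mult_linear_continuous_on
        continuous_on_compose2[of UNIV "(*v) A"] continuous_on_compose2[of UNIV "(*v) B"]) auto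
  have "axis undefined 1 \<in> sphere (0::real^'n) 1"
    by simp
  then have "(sphere (0::real^'n) 1) \<times> {0..1::real} \<noteq> {}"
    by (metis Sigma_empty_iff atLeastatMost_empty_iff2 empty_iff zero_le_one)
  then obtain z where z: "z \<in> (sphere (0::real^'n) 1) \<times> {0..1::real}"
      "\<And>z'. z' \<in> sphere 0 1 \<times> {0..1} \<Longrightarrow> norm (H z) \<le> norm (H z')"
    using continuous_attains_inf[of "(sphere (0::real^'n) 1) \<times> {0..1::real}" "\<lambda>z. norm (H z)"]
    by (metis compact_Icc compact_Times compact_sphere cont continuous_on_norm)
  have "H z \<noteq> 0"
  proof
    assume "H z = 0"
    then have "fst z = 0"
      using z(1) assms[of "snd z" "fst z"] by (simp add: H_def case_prod_beta mem_Times_iff)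
    then show False using z(1) by (simp add: mem_Times_iff)
  qed
  have "deg (\<lambda>x. H (x, 0)) UNIV 0 = deg (\<lambda>x. H (x, 1)) UNIV 0"
  proof (rule deg_homotopy_UNIV[where c="norm (H z)" and C=0 and \<alpha>="\<lambda>_. 0"])
    fix x and t :: real assume t: "t \<in> {0..1}"
    have "norm (H z) * norm x \<le> norm (H (x, t))"
    proof (cases "x = 0")
      case False
      \<comment> \<open>Homogeneity in \<open>x\<close> carries the minimum on the sphere to all
        vectors.\<close>
      have H: "H (x /\<^sub>R norm x, t) = H (x, t) /\<^sub>R norm x"
        by (simp add: H_def matrix_vector_mult_scaleR scaleR_add_right mult.commute)
      have "norm (H z) \<le> norm (H (x /\<^sub>R norm x, t))"
        using t False by (intro z(2)) auto
      also have "\<dots> = norm (H (x, t)) / norm x"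
        unfolding H by (simp add: divide_inverse_commute)
      finally show ?thesis
        using False by (simp add: field_simps)
    qed (simp add: H_def)
    then show "norm (H z) * norm x \<le> norm (H (x, t)) + 0" by simp
  qed (use \<open>H z \<noteq> 0\<close> cont in \<open>auto simp: path_def\<close>)
  then show ?thesis by (simp add: H_def)
qed

text \<open>
  Gluing \<open>A\<close> and \<open>B\<close> along the hyperplane orthogonal to \<open>v\<close> gives a folded map that omits
  \<open>- A v\<close>, while \<open>A v\<close> has exactly one preimage on each side of the hyperplane.
\<close>

lemma deg_flip:
  assumes A: "det A \<noteq> 0" and B: "det B \<noteq> 0" and "v \<noteq> 0" and "s > 0"
    and Av: "A *v v = - (s *\<^sub>R (B *v v))"
    and agree: "\<And>x. v \<bullet> x = 0 \<Longrightarrow> A *v x = B *v x"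
  shows "deg ((*v) A) UNIV 0 = - deg ((*v) B) UNIV 0"
proof -
  define g where "g x = (if v \<bullet> x \<le> 0 then B *v x else A *v x)" for x
  \<comment> \<open>The coefficient runs from -1 to 1, so the equation moves from
    \<open>g x = A *v v\<close>, with two solutions, to \<open>g x = - (A *v v)\<close>, with
    none.\<close>
  define H where "H = (\<lambda>(x, t). g x + (2 * t - 1) *\<^sub>R (A *v v))"
  define f where "f = (\<lambda>x. g x - A *v v)"
  have vv: "v \<bullet> v > 0" using \<open>v \<noteq> 0\<close> by simp
  have Av': "A *v v = B *v (- (s *\<^sub>R v))"
    using Av by (simp add: matrix_vector_mult_scaleR vec.neg)
  \<comment> \<open>These are the only candidate preimages of \<open>- (A *v v)\<close>; each lies
    on the side where \<open>g\<close> uses the other matrix.\<close>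
  have nAv: "- (A *v v) = A *v (- v)" "- (A *v v) = B *v (s *\<^sub>R v)"
    using Av by (simp_all add: matrix_vector_mult_scaleR vec.neg)
  have gcont: "continuous_on UNIV g"
    unfolding g_def
    by (rule continuous_on_cases_le)
      (auto intro!: continuous_intros matrix_vector_mult_linear_continuous_on simp: agree)
  obtain a where a: "a > 0" "\<And>x. a * norm x \<le> norm (A *v x)"
    using matrix_bounded_below A by blast
  obtain b where b: "b > 0" "\<And>x. b * norm x \<le> norm (B *v x)"
    using matrix_bounded_below B by blast
  define c where "c = min a b"
  have c: "c > 0" "c * norm x \<le> norm (g x)" for x
  proof -
    show "c > 0" using a b by (simp add: c_def)
    have "c * norm x \<le> a * norm x" "c * norm x \<le> b * norm x"
      by (auto simp: c_def intro: mult_right_mono)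
    then show "c * norm x \<le> norm (g x)"
      using a(2)[of x] b(2)[of x] by (auto simp: g_def)
  qed
  have fcont: "continuous_on UNIV f"
    unfolding f_def by (intro continuous_intros gcont)
  have grow: "c * norm x \<le> norm (g x + w) + norm w" for x w
    using c(2)[of x] norm_triangle_ineq4[of "g x + w" w] by simp
  have fadm: "admissible f UNIV 0"
    using fcont c(1) grow[of _ "- (A *v v)"]
    by (auto simp: admissible_def f_def intro!: proper_on_growth[where c=c and C="norm (A *v v)"])
  have h_adm: "admissible (\<lambda>x. g x + A *v v) UNIV 0"
    using gcont c(1) grow[of _ "A *v v"]
    by (auto simp: admissible_def f_def intro!: proper_on_growth[where c=c and C="norm (A *v v)"]
        continuous_intros)
  have "deg (\<lambda>x. H (x, 0)) UNIV 0 = deg (\<lambda>x. H (x, 1)) UNIV 0"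
  proof (rule deg_homotopy_UNIV[where c=c and C="norm (A *v v)" and \<alpha>="\<lambda>_. 0"])
    show "continuous_on (UNIV \<times> {0..1}) H"
      unfolding H_def case_prod_beta
      by (intro continuous_intros continuous_on_compose2[OF gcont]) auto
    fix x and t :: real assume t: "t \<in> {0..1}"
    then have "\<bar>2 * t - 1\<bar> \<le> 1" by auto
    then have "norm ((2 * t - 1) *\<^sub>R (A *v v)) \<le> norm (A *v v)"
      by (simp add: mult_left_le_one_le)
    then show "c * norm x \<le> norm (H (x, t)) + norm (A *v v)"
      using grow[of x "(2 * t - 1) *\<^sub>R (A *v v)"] by (simp add: H_def)
  qed (use c in \<open>auto simp: path_def\<close>)
  then have "deg f UNIV 0 = deg (\<lambda>x. g x + A *v v) UNIV 0"
    by (simp add: H_def f_def)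
  also have "\<dots> = 0"
  proof (rule deg_no_zeros[OF h_adm])
    have "g x \<noteq> - (A *v v)" for x
    proof (cases "v \<bullet> x \<le> 0")
      case True
      then have "x \<noteq> s *\<^sub>R v"
        using mult_pos_pos[OF \<open>s > 0\<close> vv] by auto
      then have "g x \<noteq> B *v (s *\<^sub>R v)"
        using True det_nonzero_cancel[OF B] by (simp add: g_def)
      then show ?thesis using nAv by simp
    next
      case False
      then have "g x \<noteq> A *v (- v)"
        using vv det_nonzero_cancel[OF A] by (auto simp: g_def)
      then show ?thesis using nAv by simp
    qed
    then show "(\<lambda>x. g x + A *v v) -` {0} \<inter> UNIV = {}"
      by (auto simp: eq_neg_iff_add_eq_0)
  qed
  finally have f0: "deg f UNIV 0 = 0" .
  define U1 U2 where "U1 = {x. v \<bullet> x > 0}" and "U2 = {x. v \<bullet> x < 0}"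
  have opn: "open U1" "open U2"
    by (auto simp: U1_def U2_def open_halfspace_gt open_halfspace_lt)
  have z1: "A *v x - A *v v = 0 \<Longrightarrow> x = v" for x
    using det_nonzero_cancel[OF A] by simp
  have z2: "B *v x - A *v v = 0 \<Longrightarrow> x = - (s *\<^sub>R v)" for x
    using det_nonzero_cancel[OF B] by (simp add: Av')
  have zf: "f -` {0} \<inter> UNIV \<subseteq> U1 \<union> U2"
  proof
    fix x assume "x \<in> f -` {0} \<inter> UNIV"
    then have "x = v \<or> x = - (s *\<^sub>R v)"
      using z1[of x] z2[of x] by (auto simp: f_def g_def split: if_splits)
    then show "x \<in> U1 \<union> U2"
      using vv \<open>s > 0\<close> by (auto simp: U1_def U2_def)
  qed
  have cl1: "closure U1 \<subseteq> {x. v \<bullet> x \<ge> 0}"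
    by (rule closure_minimal) (auto simp: U1_def closed_halfspace_ge)
  have cl2: "closure U2 \<subseteq> {x. v \<bullet> x \<le> 0}"
    by (rule closure_minimal) (auto simp: U2_def closed_halfspace_le)
  have fz0: "f x \<noteq> 0" if "v \<bullet> x = 0" for x
    using zf that by (auto simp: U1_def U2_def)
  \<comment> \<open>A frontier point is in the closed half-space but not in the open one.\<close>
  have fr: "v \<bullet> x = 0" if "x \<in> frontier U1 \<or> x \<in> frontier U2" for x
    using that cl1 cl2 opn by (fastforce simp: frontier_def interior_open U1_def U2_def)
  \<comment> \<open>On the hyperplane \<open>g\<close> is computed with \<open>B\<close>, so
    \<open>agree\<close> is what makes \<open>f\<close> affine on all of \<open>closure U1\<close>.
    Excision then passes to the whole space, the only zero being \<open>v\<close>.\<close>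
  have "deg f U1 0 = deg (\<lambda>x. A *v x - A *v v) U1 0"
  proof (rule deg_cong)
    show "admissible f U1 0"
      using fadm opn fr fz0 by (auto intro: admissible_mono)
    show "f x = A *v x - A *v v" if "x \<in> closure U1" for x
      using that cl1 agree[of x] by (auto simp: f_def g_def)
  qed
  also have "\<dots> = deg (\<lambda>x. A *v x - A *v v) UNIV 0"
    using admissible_affine[OF A, of "- (A *v v)" 0] opn vv
    by (intro deg_excision[symmetric]) (auto simp: U1_def dest!: z1)
  also have "\<dots> = deg ((*v) A) UNIV 0"
    using deg_affine[OF A, of "- (A *v v)" 0] by simp
  finally have d1: "deg f U1 0 = deg ((*v) A) UNIV 0" .
  have "deg f U2 0 = deg (\<lambda>x. B *v x - A *v v) U2 0"
  proof (rule deg_cong)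
    show "admissible f U2 0"
      using fadm opn fr fz0 by (auto intro: admissible_mono)
    show "f x = B *v x - A *v v" if "x \<in> closure U2" for x
      using that cl2 by (auto simp: f_def g_def)
  qed
  also have "\<dots> = deg (\<lambda>x. B *v x - A *v v) UNIV 0"
    using admissible_affine[OF B, of "- (A *v v)" 0] opn vv \<open>s > 0\<close>
    by (intro deg_excision[symmetric]) (auto simp: U2_def dest!: z2)
  also have "\<dots> = deg ((*v) B) UNIV 0"
    using deg_affine[OF B, of "- (A *v v)" 0] by simp
  finally have d2: "deg f U2 0 = deg ((*v) B) UNIV 0" .
  have "deg f UNIV 0 = deg f U1 0 + deg f U2 0"
    by (rule deg_additive[OF fadm opn]) (use zf in \<open>auto simp: U1_def U2_def\<close>)
  then show ?thesis
    using f0 d1 d2 by simp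
qed

text \<open>The set \<open>S\<close> serves the induction, which changes one diagonal entry at a
  time from 1 to \<open>d k\<close>: by a segment if it is positive, by a flip if it is
  negative.\<close>

lemma deg_mult_diagonal:
  fixes B :: "real^'n^'n"
  assumes B: "det B \<noteq> 0" and d: "\<And>i. d i \<noteq> 0" and "finite S"
  shows "real_of_int (deg ((*v) (B ** (\<chi> i j. if i = j then if i \<in> S then d i else 1 else 0))) UNIV 0)
    = sgn (\<Prod>i\<in>S. d i) * deg ((*v) B) UNIV 0"
  using \<open>finite S\<close>
proof (induction S)
  case empty
  have "(\<chi> i j. if i = j then if i \<in> {} then d i else 1 else 0) = (mat 1 :: real^'n^'n)"
    by (simp add: mat_def vec_eq_iff)
  then show ?case by simp
next
  case (insert k S)
  define E where "E S = (\<chi> i j. if i = j then if i \<in> S then d i else 1 else 0 :: real^'n^'n)" for S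
  have E: "(E S *v x) $ i = (if i \<in> S then d i else 1) * x $ i" for S x i
    by (simp add: E_def matrix_vector_mult_def if_distrib[of "\<lambda>u. u * _"] cong: if_cong)
  have detE: "det (E S) \<noteq> 0" for S
    by (subst det_diagonal) (auto simp: E_def d)
  have BE: "det (B ** E S) \<noteq> 0" for S
    using detE B by (simp add: det_mul)
  have E': "E (insert k S) *v x = E S *v x" if "x $ k = 0" for x
    using that by (auto simp: vec_eq_iff E)
  have "real_of_int (deg ((*v) (B ** E (insert k S))) UNIV 0)
      = sgn (d k) * deg ((*v) (B ** E S)) UNIV 0"
  proof (cases "d k > 0")
    case True
    have "deg ((*v) (B ** E (insert k S))) UNIV 0 = deg ((*v) (B ** E S)) UNIV 0"
    proof (rule deg_segment)
      fix t :: real and x :: "real^'n" assume t: "t \<in> {0..1}"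
        and "(1 - t) *\<^sub>R ((B ** E (insert k S)) *v x) + t *\<^sub>R ((B ** E S) *v x) = 0"
      then have "B *v ((1 - t) *\<^sub>R (E (insert k S) *v x) + t *\<^sub>R (E S *v x)) = B *v 0"
        by (simp add: matrix_vector_mul_assoc[symmetric] matrix_vector_right_distrib
            matrix_vector_mult_scaleR)
      then have z: "(1 - t) *\<^sub>R (E (insert k S) *v x) + t *\<^sub>R (E S *v x) = 0"
        using det_nonzero_cancel[OF B] by blast
      have "x $ i = 0" for i
      proof -
        have "(1 - t) * (E (insert k S) *v x) $ i + t * (E S *v x) $ i = 0"
          using arg_cong[OF z, of "\<lambda>u. u $ i"] by simp
        then have "((1 - t) * (if i = k \<or> i \<in> S then d i else 1)
            + t * (if i \<in> S then d i else 1)) * x $ i = 0"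
          by (simp add: E algebra_simps)
        \<comment> \<open>A convex combination of 1 and the positive \<open>d k\<close> cannot
          vanish; the other diagonal entries are constant along the segment.\<close>
        moreover have "(1 - t) * d k + t > 0"
          using t True by (cases "t = 0") (auto intro: add_nonneg_pos)
        moreover have "(1 - t) * u + t * u = u" for u :: real
          by (simp add: algebra_simps)
        ultimately show ?thesis
          using d[of i] insert.hyps by (cases "i = k") (auto split: if_splits)
      qed
      then show "x = 0" by (simp add: vec_eq_iff)
    qed
    then show ?thesis using True by simp
  next
    case False
    then have neg: "d k < 0" using d[of k] by simp
    have "deg ((*v) (B ** E (insert k S))) UNIV 0 = - deg ((*v) (B ** E S)) UNIV 0"
    \<comment> \<open>The two diagonal matrices differ only on this axis, where one scales by
      \<open>d k\<close> and the other is the identity.\<close>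
    proof (rule deg_flip[OF BE BE, where v="axis k 1" and s="- d k"])
      have 1: "E (insert k S) *v axis k 1 = d k *\<^sub>R axis k 1"
        by (simp add: vec_eq_iff E axis_def)
      have 2: "E S *v axis k 1 = axis k 1"
        using insert.hyps by (auto simp: vec_eq_iff E axis_def)
      show "(B ** E (insert k S)) *v axis k 1 = - (- d k *\<^sub>R ((B ** E S) *v axis k 1))"
        by (simp add: matrix_vector_mul_assoc[symmetric] 1 2 matrix_vector_mult_scaleR)
      show "(B ** E (insert k S)) *v x = (B ** E S) *v x" if "axis k 1 \<bullet> x = 0" for x
        using that by (simp add: matrix_vector_mul_assoc[symmetric] E' inner_axis')
    qed (use neg in auto)
    then show ?thesis using neg by simp
  qed
  then show ?case
    using insert by (simp add: E_def sgn_mult)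
qed

text \<open>The property passes to products in \<open>A\<close>, so it suffices to check elementary
  matrices.\<close>

lemma deg_mult:
  assumes "det A \<noteq> 0" "det B \<noteq> 0"
  shows "real_of_int (deg ((*v) (B ** A)) UNIV 0) = sgn (det A) * deg ((*v) B) UNIV 0"
proof -
  \<comment> \<open>\<open>B\<close> is quantified because the product case uses the hypothesis on
    the second factor at \<open>B ** A1\<close>. Invertibility of \<open>A\<close> sits inside the
    induction, so a zero row is vacuous.\<close>
  have "det A \<noteq> 0 \<longrightarrow> (\<forall>B. det B \<noteq> 0 \<longrightarrow>
    real_of_int (deg ((*v) (B ** A)) UNIV 0) = sgn (det A) * deg ((*v) B) UNIV 0)"
  proof (induction A rule: induct_matrix_elementary[case_names mult zero_row diagonal swap1 idplus])
    case (mult A1 A2)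
    show ?case
    proof (intro impI allI)
      fix B :: "real^'n^'n" assume "det (A1 ** A2) \<noteq> 0" and B: "det B \<noteq> 0"
      then have 12: "det A1 \<noteq> 0" "det A2 \<noteq> 0"
        by (auto simp: det_mul)
      have "real_of_int (deg ((*v) ((B ** A1) ** A2)) UNIV 0) = sgn (det A2) * deg ((*v) (B ** A1)) UNIV 0"
        using mult(2) 12 B by (simp add: det_mul)
      also have "\<dots> = sgn (det A2) * (sgn (det A1) * deg ((*v) B) UNIV 0)"
        using mult(1) 12 B by simp
      finally show "real_of_int (deg ((*v) (B ** (A1 ** A2))) UNIV 0)
          = sgn (det (A1 ** A2)) * deg ((*v) B) UNIV 0"
        by (simp add: det_mul sgn_mult matrix_mul_assoc)
    qed
  next
    case (zero_row A i)
    then show ?case by (simp add: det_zero_row)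
  next
    case (diagonal A)
    show ?case
    proof (intro impI allI)
      fix B :: "real^'n^'n" assume A: "det A \<noteq> 0" and B: "det B \<noteq> 0"
      have "det A = (\<Prod>i\<in>UNIV. A $ i $ i)"
        using det_diagonal diagonal by blast
      moreover have "(\<chi> i j. if i = j then if i \<in> UNIV then A $ i $ i else 1 else 0) = A"
        using diagonal by (auto simp: vec_eq_iff)
      moreover have "A $ i $ i \<noteq> 0" for i
        using A calculation(1) by auto
      ultimately show "real_of_int (deg ((*v) (B ** A)) UNIV 0) = sgn (det A) * deg ((*v) B) UNIV 0"
        using deg_mult_diagonal[OF B, of "\<lambda>i. A $ i $ i" UNIV] by simp
    qed
  next
    case (swap1 m n)
    define P where "P = (\<chi> i j. (mat 1 :: real^'n^'n) $ i $ Transposition.transpose m n j)"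
    have detP: "det P = - 1"
      unfolding P_def
      by (subst det_permute_columns) (use swap1 in \<open>auto simp: permutes_swap_id sign_swap_id\<close>)
    have P: "(P *v x) $ i = x $ Transposition.transpose m n i" for x i
    proof -
      have "(P *v x) $ i = (\<Sum>j\<in>UNIV. if j = Transposition.transpose m n i then x $ j else 0)"
        unfolding P_def matrix_vector_mult_def mat_def vec_lambda_beta
        by (rule sum.cong) (auto simp: transpose_eq_iff)
      then show ?thesis by simp
    qed
    show ?case
      unfolding P_def[symmetric]
    proof (intro impI allI)
      fix B :: "real^'n^'n" assume B: "det B \<noteq> 0"
      have "deg ((*v) (B ** P)) UNIV 0 = - deg ((*v) B) UNIV 0"
      \<comment> \<open>Swapping two coordinates is the reflection in the hyperplane
        \<open>x $ m = x $ n\<close>, whose normal is this vector.\<close>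
      proof (rule deg_flip[OF _ B, where v="axis m 1 - axis n 1" and s=1])
        show "det (B ** P) \<noteq> 0" using B detP by (simp add: det_mul)
        show "axis m 1 - axis n 1 \<noteq> (0::real^'n)"
          using swap1 by (simp add: axis_eq_axis)
        have "P *v (axis m 1 - axis n 1) = - (axis m 1 - axis n 1)"
          using swap1 by (auto simp: vec_eq_iff P axis_def Transposition.transpose_def)
        then show "(B ** P) *v (axis m 1 - axis n 1) = - (1 *\<^sub>R (B *v (axis m 1 - axis n 1)))"
          by (simp add: matrix_vector_mul_assoc[symmetric] flip: vec.neg)
        fix x :: "real^'n" assume "(axis m 1 - axis n 1) \<bullet> x = 0"
        then have "x $ m = x $ n"
          by (simp add: inner_diff_left inner_axis')
        then have "P *v x = x"
          by (auto simp: vec_eq_iff P Transposition.transpose_def)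
        then show "(B ** P) *v x = B *v x"
          by (simp add: matrix_vector_mul_assoc[symmetric])
      qed simp
      then show "real_of_int (deg ((*v) (B ** P)) UNIV 0) = sgn (det P) * deg ((*v) B) UNIV 0"
        by (simp add: detP)
    qed
  next
    case (idplus m n c)
    define E where "E = (\<chi> i j. if i = m \<and> j = n then c else of_bool (i = j) :: real^'n^'n)"
    have "E = (\<chi> k. if k = m then row m (mat 1) + c *s row n (mat 1) else row k (mat 1))"
      using idplus by (auto simp: vec_eq_iff E_def row_def mat_def)
    then have detE: "det E = 1"
      using det_row_operation[OF idplus, of "mat 1" c] by simp
    have E: "(E *v x) $ i = (if i = m then x $ m + c * x $ n else x $ i)" for x i
    proof -
      have "(E *v x) $ i = (\<Sum>j\<in>UNIV. (if j = i then x $ j else 0) + (if j = n then if i = m then c * x $ j else 0 else 0))"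
        unfolding E_def matrix_vector_mult_def using idplus
        by (auto intro!: sum.cong)
      then show ?thesis by (simp add: sum.distrib)
    qed
    show ?case
      unfolding E_def[symmetric]
    proof (intro impI allI)
      fix B :: "real^'n^'n" assume B: "det B \<noteq> 0"
      have "deg ((*v) (B ** E)) UNIV 0 = deg ((*v) B) UNIV 0"
      proof (rule deg_segment)
        fix t :: real and x :: "real^'n"
        assume "(1 - t) *\<^sub>R ((B ** E) *v x) + t *\<^sub>R (B *v x) = 0"
        then have "B *v ((1 - t) *\<^sub>R (E *v x) + t *\<^sub>R x) = B *v 0"
          by (simp add: matrix_vector_mul_assoc[symmetric] matrix_vector_right_distrib
              matrix_vector_mult_scaleR)
        then have z: "(1 - t) *\<^sub>R (E *v x) + t *\<^sub>R x = 0"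
          using det_nonzero_cancel[OF B] by blast
        have z': "(1 - t) * (E *v x) $ i + t * x $ i = 0" for i
          using arg_cong[OF z, of "\<lambda>u. u $ i"] by simp
        \<comment> \<open>Every matrix between a shear and the identity is again a shear:
          coordinates other than \<open>m\<close> are fixed, and once they vanish so does the
          contribution of \<open>x $ n\<close> to coordinate \<open>m\<close>.\<close>
        have 1: "x $ i = 0" if "i \<noteq> m" for i
          using z'[of i] that by (simp add: E algebra_simps)
        have "x $ m = 0"
          using z'[of m] 1[of n] idplus by (simp add: E algebra_simps)
        with 1 show "x = 0" by (metis vec_eq_iff zero_index)
      qed
      then show "real_of_int (deg ((*v) (B ** E)) UNIV 0) = sgn (det E) * deg ((*v) B) UNIV 0"
        by (simp add: detE)
    qed
  qed
  then show ?thesis using assms by blast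
qed

text \<open>Normalization enters here, as the value at the identity matrix.\<close>

lemma deg_linear:
  assumes "det A \<noteq> 0"
  shows "real_of_int (deg ((*v) A) UNIV 0) = sgn (det A)"
proof -
  have "deg ((*v) (mat 1)) UNIV 0 = 1"
    using deg unfolding brouwer_degree_def by (simp add: matrix_vector_mul_lid[abs_def])
  then show ?thesis
    using deg_mult[OF assms, of "mat 1"] by simp
qed

section \<open>Localisation at regular zeros\<close>

text \<open>Near a regular zero the linear part dominates the remainder. One radius \<open>e\<close>
  gives both isolation and the local degree; \<open>r\<close> stays free so that the ball can later
  be fitted into \<open>U\<close>. Continuity on \<open>cball x r\<close> is assumed because
  differentiability at \<open>x\<close> does not supply it.\<close>

lemma deg_regular_zero:
  assumes "f differentiable (at x)" "invertible (jacobian f (at x))" "f x = y"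
  obtains e where "e > 0" "\<And>z. \<lbrakk>z \<in> ball x e; f z = y\<rbrakk> \<Longrightarrow> z = x"
    "\<And>r. \<lbrakk>0 < r; r < e; continuous_on (cball x r) f\<rbrakk> \<Longrightarrow> deg f (ball x r) y = point_index f x"
proof -
  define J where "J = jacobian f (at x)"
  have J: "det J \<noteq> 0"
    using assms by (simp add: J_def invertible_det_nz)
  have der: "(f has_derivative (*v) J) (at x)"
    using assms(1) by (simp add: jacobian_works J_def)
  obtain c where c: "c > 0" "\<And>h. c * norm h \<le> norm (J *v h)"
    using matrix_bounded_below J by blast
  \<comment> \<open>Half of the lower bound \<open>c\<close> keeps the remainder strictly below the
    linear part away from \<open>x\<close>.\<close>
  obtain e where e: "e > 0"
    "\<And>z. norm (z - x) < e \<Longrightarrow> norm (f z - f x - J *v (z - x)) \<le> c / 2 * norm (z - x)"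
    using der c(1) unfolding has_derivative_at_alt by (meson half_gt_zero)
  \<comment> \<open>Time 0 gives isolation of the zero; all times together keep the homotopy to the
    affine approximation off \<open>y\<close> on small spheres.\<close>
  have key: "z = x" if z: "z \<in> ball x e" and t: "t \<in> {0..1}"
    and eq: "(1 - t) *\<^sub>R f z + t *\<^sub>R (J *v z + (y - J *v x)) = y" for z and t :: real
  proof -
    define R where "R = f z - f x - J *v (z - x)"
    have "J *v (z - x) = - ((1 - t) *\<^sub>R R)"
      using eq by (simp add: R_def assms(3) matrix_vector_mult_diff_distrib algebra_simps)
    then have "norm (J *v (z - x)) = (1 - t) * norm R"
      using t by simp
    also have "\<dots> \<le> 1 * norm R"
      using t by (intro mult_right_mono) auto
    also have "\<dots> \<le> c / 2 * norm (z - x)"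
      using e(2)[of z] z by (simp add: R_def dist_norm norm_minus_commute)
    finally have "c * norm (z - x) \<le> c / 2 * norm (z - x)"
      using c(2)[of "z - x"] by linarith
    then show "z = x"
      using c(1) by auto
  qed
  show ?thesis
  proof (rule that[OF e(1)])
    show "z = x" if "z \<in> ball x e" "f z = y" for z
      using key[of z 0] that by simp
    fix r assume r: "0 < r" "r < e" and cont: "continuous_on (cball x r) f"
    define H where "H = (\<lambda>(z, t). (1 - t) *\<^sub>R f z + t *\<^sub>R (J *v z + (y - J *v x)))"
    have "proper_on (cball x r \<times> {0..1}) H"
    proof (rule proper_on_compact)
      show "continuous_on (cball x r \<times> {0..1}) H"
        unfolding H_def case_prod_beta
        by (intro continuous_intros continuous_on_compose2[OF cont]
            continuous_on_compose2[of UNIV "(*v) J"]) auto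
    qed (auto intro: compact_Times)
    moreover have "H (z, t) \<noteq> y" if "z \<in> sphere x r" "t \<in> {0..1}" for z t
      using key[of z t] that r by (auto simp: H_def)
    ultimately have "admissible_homotopy H (ball x r) (\<lambda>_. y)"
      using r by (simp add: admissible_homotopy_def path_def)
    from deg_homotopy[OF this] have "deg f (ball x r) y = deg (\<lambda>z. J *v z + (y - J *v x)) (ball x r) y"
      by (simp add: H_def)
    also have "\<dots> = deg (\<lambda>z. J *v z + (y - J *v x)) UNIV y"
      using r det_nonzero_cancel[OF J]
      by (intro deg_excision[symmetric] admissible_affine J) (auto simp: algebra_simps)
    also have "\<dots> = deg ((*v) J) UNIV 0"
      using deg_affine[OF J] by simp
    also have "\<dots> = point_index f x"
    proof -
      have "real_of_int (point_index f x) = sgn (det J)"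
        by (simp add: point_index_def J_def sgn_if)
      then show ?thesis using deg_linear[OF J] by linarith
    qed
    finally show "deg f (ball x r) y = point_index f x" .
  qed
qed

text \<open>The zero set is compact by properness, so if infinite it would have a limit point in
  itself, but regular zeros are isolated.\<close>

lemma finite_regular_zeros:
  fixes f :: "real^'n \<Rightarrow> real^'n"
  assumes "admissible f U y"
    and reg: "\<And>x. x \<in> f -` {y} \<inter> U \<Longrightarrow>
           f differentiable (at x) \<and> invertible (jacobian f (at x))"
  shows "finite (f -` {y} \<inter> U)"
proof (rule ccontr)
  let ?Z = "f -` {y} \<inter> U"
  assume "infinite ?Z"
  moreover have "compact ?Z"
    using assms(1) unfolding admissible_zeros[OF assms(1)] admissible_def proper_on_def by auto
  ultimately obtain x where x: "x \<in> ?Z" "x islimpt ?Z"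
    by (meson compact_eq_Bolzano_Weierstrass order_refl)
  have "f differentiable (at x)" "invertible (jacobian f (at x))" "f x = y"
    using reg x(1) by auto
  then obtain e where "e > 0" "\<And>z. \<lbrakk>z \<in> ball x e; f z = y\<rbrakk> \<Longrightarrow> z = x"
    using deg_regular_zero by metis
  then show False
    using x(2) by (auto simp: islimpt_approachable dist_commute)
qed

text \<open>Induction on the zero set with \<open>U\<close> varying: removing a closed ball around
  one zero leaves an admissible triple with the remaining zeros.\<close>

lemma deg_sum_regular_zeros:
  assumes "finite Z" "admissible f U y" "f -` {y} \<inter> U = Z"
    and "\<And>x. x \<in> Z \<Longrightarrow> f differentiable (at x) \<and> invertible (jacobian f (at x))"
  shows "deg f U y = (\<Sum>x\<in>Z. point_index f x)"
  using assms
proof (induction Z arbitrary: U)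
  case empty
  then show ?case using deg_no_zeros by simp
next
  case (insert x Z)
  have x: "f x = y" "x \<in> U" and "open U" and cont: "continuous_on (closure U) f"
    using insert.prems by (auto simp: admissible_def proper_on_def)
  obtain e where e: "e > 0" "\<And>z. \<lbrakk>z \<in> ball x e; f z = y\<rbrakk> \<Longrightarrow> z = x"
    "\<And>r. \<lbrakk>0 < r; r < e; continuous_on (cball x r) f\<rbrakk> \<Longrightarrow> deg f (ball x r) y = point_index f x"
    using deg_regular_zero[of f x y] insert.prems x by auto
  obtain d where d: "d > 0" "cball x d \<subseteq> U"
    using \<open>open U\<close> x open_contains_cball by blast
  \<comment> \<open>Halving \<open>e\<close> puts even the closed ball inside
    \<open>ball x e\<close>, and \<open>d\<close> keeps it inside \<open>U\<close>.\<close>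
  define r where "r = min (e / 2) d"
  have r: "0 < r" "r < e" "cball x r \<subseteq> U"
    using e(1) d by (auto simp: r_def)
  have "cball x r \<subseteq> closure U"
    using r(3) closure_subset by blast
  then have b: "deg f (ball x r) y = point_index f x"
    using e(3) r cont continuous_on_subset by blast
  let ?V = "U - cball x r"
  have opV: "open ?V" using \<open>open U\<close> by auto
  have "z = x" if "f z = y" "z \<in> cball x r" for z
    using e(2)[of z] that r by auto
  then have "f -` {y} \<inter> ?V = f -` {y} \<inter> U - {x}"
    using x r by auto
  then have zV: "f -` {y} \<inter> ?V = Z"
    using insert.prems(2) insert.hyps(2) by auto
  \<comment> \<open>A zero on the new frontier would lie in \<open>U\<close>, hence in the removed
    ball, hence be \<open>x\<close>; but \<open>ball x r\<close> is a neighbourhood of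
    \<open>x\<close> missing \<open>closure ?V\<close>.\<close>
  have "f z \<noteq> y" if "z \<in> frontier ?V" for z
  proof
    assume fz: "f z = y"
    have z: "z \<in> closure ?V" "z \<notin> ?V"
      using that opV by (auto simp: frontier_def interior_open)
    have "z \<in> closure U" using z(1) closure_mono[of ?V U] by auto
    then have "z \<in> U" using fz admissible_zeros[OF insert.prems(1)] by auto
    then have "z \<in> cball x r" using z(2) by auto
    then have "z = x" using e(2) fz r by auto
    moreover have "ball x r \<inter> closure ?V = {}"
      by (subst open_Int_closure_eq_empty) auto
    moreover have "x \<in> ball x r" using r by simp
    ultimately show False using z(1) by blast
  qed
  then have "admissible f ?V y"
    using admissible_mono[OF insert.prems(1) opV] by auto
  then have "deg f ?V y = (\<Sum>x\<in>Z. point_index f x)"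
    using insert.IH zV insert.prems(3) by auto
  moreover have "deg f U y = deg f (ball x r) y + deg f ?V y"
  proof (rule deg_additive[OF insert.prems(1)])
    show "f -` {y} \<inter> U \<subseteq> ball x r \<union> ?V"
      using insert.prems(2) zV r by auto
  qed (use opV r in \<open>auto simp: subset_iff\<close>)
  ultimately show ?case
    using b insert.hyps by simp
qed

end

theorem theorem3p15:
  fixes deg :: "(real^'n \<Rightarrow> real^'n) \<Rightarrow> (real^'n) set \<Rightarrow> real^'n \<Rightarrow> int"
    and f :: "real^'n \<Rightarrow> real^'n" and U :: "(real^'n) set" and y :: "real^'n"
  assumes "brouwer_degree deg"
    and "admissible f U y"
    and "\<And>x. x \<in> f -` {y} \<inter> U \<Longrightarrow>
           f differentiable (at x) \<and> invertible (jacobian f (at x))"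
  shows "finite (f -` {y} \<inter> U) \<and>
         deg f U y = (\<Sum>x\<in>f -` {y} \<inter> U. point_index f x)"
  using finite_regular_zeros[OF assms] deg_sum_regular_zeros[OF assms(1) _ assms(2) refl assms(3)]
  by blast

end
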